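(* Let $T$ be a tree with $n$ vertices and let the evolver be adversarial (each evolver step swaps the labels at the endpoints of an arbitrarily chosen edge). Run Algorithm 1 with any speedup factor $c>2$ from an arbitrary initial hypothesis. Then there exists $z$ (a function of $n$) such that for all $j>z$, $D(\mathcal{T},\mathcal{H})_j\in O(n)$.
   Context: Setting: $T=(V,E)$ is a fixed tree with $n$ vertices; labels $L=\{l_1,\dots,l_n\}$ are placed by a bijection $M_T:L\to V$, which an evolver changes by swapping the labels across an edge of $T$. The algorithm keeps a map $M_H:L\to V$ (not necessarily injective). An oracle $\mathcal{O}(l,u)$ returns null if $M_T(l)=u$ and otherwise the edge $(u,v)$ incident to $u$ on the tree path from $u$ to $M_T(l)$. Algorithm 1 repeats forever an iteration: for $i=1,\dots,n$, while $\mathcal{O}(l_i,M_H(l_i))\neq$ null, set $(u,v)\gets\mathcal{O}(l_i,M_H(l_i))$ and $M_H(l_i)\gets v$. With speedup $c$, the algorithm performs one oracle query per time unit and the evolver one swap every $c$ time units. The distance is $D(\mathcal{T},\mathcal{H})=\sum_{l\in L} d_T(M_T(l),M_H(l))$ with $d_T$ the tree path length, and $D(\mathcal{T},\mathcal{H})_j$ denotes its value at the start of the $j$-th iteration. *)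

theory Defs
  imports Complex_Main "HOL-Library.Landau_Symbols" "HOL-Combinatorics.Transposition"
begin

(* Undirected simple graphs: vertex set V, edges are two-element subsets of V. The notion "tree"
   of the AFP entry Graph_Theory only forbids directed cycles, so a transitively oriented
   triangle satisfies it; it is therefore not used here. *)

definition simple_graph :: "'v set \<Rightarrow> 'v set set \<Rightarrow> bool" where
  "simple_graph V E \<longleftrightarrow> finite V \<and> (\<forall>e\<in>E. \<exists>u\<in>V. \<exists>v\<in>V. u \<noteq> v \<and> e = {u, v})"

definition simple_path :: "'v set \<Rightarrow> 'v set set \<Rightarrow> 'v \<Rightarrow> 'v list \<Rightarrow> 'v \<Rightarrow> bool" where
  "simple_path V E u p v \<longleftrightarrow>
     p \<noteq> [] \<and> hd p = u \<and> last p = v \<and> set p \<subseteq> V \<and> distinct p \<and>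
     successively (\<lambda>x y. {x, y} \<in> E) p"

definition is_cycle :: "'v set set \<Rightarrow> 'v list \<Rightarrow> bool" where
  "is_cycle E p \<longleftrightarrow>
     length p \<ge> 3 \<and> distinct p \<and> successively (\<lambda>x y. {x, y} \<in> E) p \<and> {last p, hd p} \<in> E"

definition is_tree :: "'v set \<Rightarrow> 'v set set \<Rightarrow> bool" where
  "is_tree V E \<longleftrightarrow>
     simple_graph V E \<and> V \<noteq> {} \<and>
     (\<forall>u\<in>V. \<forall>v\<in>V. \<exists>p. simple_path V E u p v) \<and> (\<nexists>p. is_cycle E p)"

definition tree_path :: "'v set \<Rightarrow> 'v set set \<Rightarrow> 'v \<Rightarrow> 'v \<Rightarrow> 'v list" where
  "tree_path V E u v = (THE p. simple_path V E u p v)"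

definition tree_dist :: "'v set \<Rightarrow> 'v set set \<Rightarrow> 'v \<Rightarrow> 'v \<Rightarrow> nat" where
  "tree_dist V E u v = length (tree_path V E u v) - 1"

(* The n labels are given as a list ls, in the order l_1, ..., l_n in which they are processed. *)

definition total_dist ::
  "'v set \<Rightarrow> 'v set set \<Rightarrow> 'l list \<Rightarrow> ('l \<Rightarrow> 'v) \<Rightarrow> ('l \<Rightarrow> 'v) \<Rightarrow> nat" where
  "total_dist V E ls MT MH = (\<Sum>l\<in>set ls. tree_dist V E (MT l) (MH l))"

(* None encodes the answer null; in Some (u, v), v is the vertex following u on the path. *)

definition path_query ::
  "'v set \<Rightarrow> 'v set set \<Rightarrow> ('l \<Rightarrow> 'v) \<Rightarrow> 'l \<Rightarrow> 'v \<Rightarrow> ('v \<times> 'v) option" where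
  "path_query V E MT l u =
     (if MT l = u then None else Some (u, tree_path V E u (MT l) ! 1))"

(* The one-vertex tree has no edge to swap across, so there the labelling cannot change. *)

definition evolver_step :: "'v set set \<Rightarrow> ('l \<Rightarrow> 'v) \<Rightarrow> ('l \<Rightarrow> 'v) \<Rightarrow> bool" where
  "evolver_step E M M' \<longleftrightarrow>
     (\<exists>u v. {u, v} \<in> E \<and> M' = transpose u v \<circ> M) \<or> (E = {} \<and> M' = M)"

(* M k is the true labelling after k evolver steps. The algorithm is deterministic, so ranging
   over all such sequences also covers an adversary that reacts to the algorithm. *)

definition evolution :: "'v set set \<Rightarrow> (nat \<Rightarrow> 'l \<Rightarrow> 'v) \<Rightarrow> bool" where
  "evolution E M \<longleftrightarrow> (\<forall>k. evolver_step E (M k) (M (Suc k)))"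

(* The k-th swap (k = 1, 2, ...) takes place at time k * c; c need not be an integer. *)

definition truth_at :: "real \<Rightarrow> (nat \<Rightarrow> 'l \<Rightarrow> 'v) \<Rightarrow> nat \<Rightarrow> 'l \<Rightarrow> 'v" where
  "truth_at c M t = M (nat \<lfloor>real t / c\<rfloor>)"

(* cur_iter counts iterations from 1; cur_label is the position in ls, counted from 0, of the
   label being processed. *)

record ('l, 'v) alg_state =
  cur_iter :: nat
  cur_label :: nat
  hypothesis :: "'l \<Rightarrow> 'v"

(* One time unit of the algorithm: a single query, whose answer both decides the test of the
   while loop and, if it is not null, is used in the loop body. A null answer ends the loop for
   the current label, and after the last label the next iteration begins. *)

definition alg_step ::
  "('l \<Rightarrow> 'v \<Rightarrow> ('v \<times> 'v) option) \<Rightarrow> 'l list \<Rightarrow> ('l, 'v) alg_state \<Rightarrow> ('l, 'v) alg_state" where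
  "alg_step query ls s =
     (let l = ls ! cur_label s in
      case query l (hypothesis s l) of
        Some (u, v) \<Rightarrow> s\<lparr>hypothesis := (hypothesis s)(l := v)\<rparr>
      | None \<Rightarrow>
          (if Suc (cur_label s) < length ls
           then s\<lparr>cur_label := Suc (cur_label s)\<rparr>
           else s\<lparr>cur_iter := Suc (cur_iter s), cur_label := 0\<rparr>))"

primrec alg_run ::
  "'v set \<Rightarrow> 'v set set \<Rightarrow> 'l list \<Rightarrow> real \<Rightarrow> (nat \<Rightarrow> 'l \<Rightarrow> 'v) \<Rightarrow> ('l \<Rightarrow> 'v) \<Rightarrow> nat
     \<Rightarrow> ('l, 'v) alg_state" where
  "alg_run V E ls c M H0 0 = \<lparr>cur_iter = 1, cur_label = 0, hypothesis = H0\<rparr>"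
| "alg_run V E ls c M H0 (Suc t) =
     alg_step (path_query V E (truth_at c M t)) ls (alg_run V E ls c M H0 t)"

definition dist_at ::
  "'v set \<Rightarrow> 'v set set \<Rightarrow> 'l list \<Rightarrow> real \<Rightarrow> (nat \<Rightarrow> 'l \<Rightarrow> 'v) \<Rightarrow> ('l \<Rightarrow> 'v) \<Rightarrow> nat \<Rightarrow> nat" where
  "dist_at V E ls c M H0 t =
     total_dist V E ls (truth_at c M t) (hypothesis (alg_run V E ls c M H0 t))"

definition iteration_starts ::
  "'v set \<Rightarrow> 'v set set \<Rightarrow> 'l list \<Rightarrow> real \<Rightarrow> (nat \<Rightarrow> 'l \<Rightarrow> 'v) \<Rightarrow> ('l \<Rightarrow> 'v) \<Rightarrow> nat \<Rightarrow> nat \<Rightarrow> bool" where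
  "iteration_starts V E ls c M H0 j t \<longleftrightarrow>
     cur_iter (alg_run V E ls c M H0 t) = j \<and>
     (\<forall>s<t. cur_iter (alg_run V E ls c M H0 s) \<noteq> j)"

end

theory Submission
  imports Defs
begin

text \<open>
  Let an iteration with \<open>m\<close> non-null answers start at distance \<open>D\<close>, end at distance \<open>D'\<close>, and let
  \<open>w\<close> swaps happen while it runs; it lasts \<open>m + n\<close> time units, so \<open>w \<le> (m + n) / c + 1\<close>. A swap
  changes the distance by at most 2 and a non-null answer lowers it by 1, hence
  \<open>D' + m \<le> D + 2 w\<close>. Each label sits on its true vertex at the moment its loop ends, so
  whatever part of \<open>D\<close> the evolver has not removed is removed by the algorithm:
  \<open>D \<le> m + 2 w\<close>. For \<open>c > 2\<close> the two inequalities give \<open>D' \<le> q D + 5 n\<close> with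
  \<open>q = 4 / (c + 2) < 1\<close>, and the contraction forgets the initial distance, which is at most
  \<open>n\<^sup>2\<close>.
\<close>

section \<open>Paths in trees\<close>

lemma successively_edge_rev:
  "successively (\<lambda>x y. {x, y} \<in> E) (rev p) \<longleftrightarrow> successively (\<lambda>x y. {x, y} \<in> E) p"
  by (simp add: insert_commute)

lemma simple_path_rev:
  "simple_path V E u p v \<Longrightarrow> simple_path V E v (rev p) u"
  unfolding simple_path_def by (simp add: successively_edge_rev hd_rev last_rev del: successively_rev)

lemma simple_path_tl:
  assumes "simple_path V E u (u # a # p) v"
  shows "simple_path V E a (a # p) v"
  using assms unfolding simple_path_def by auto

lemma simple_path_closed:
  assumes "simple_path V E u p u"
  shows "p = [u]"
proof (cases p)
  case (Cons a p')
  then show ?thesis using assms unfolding simple_path_def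
    by (cases "p' = []") auto
qed (use assms in \<open>simp add: simple_path_def\<close>)

text \<open>Follow the first path to the first vertex \<open>x\<close> after \<open>u\<close> that
  also lies on the second one, then return to \<open>u\<close> along the second. Taking the first
  such \<open>x\<close> makes the two arcs disjoint, and \<open>a \<noteq> b\<close> forbids both
  arcs to be empty, so at least three vertices remain.\<close>

lemma cycle_of_forked_paths:
  assumes p: "simple_path V E u (u # a # p) v" and q: "simple_path V E u (u # b # q) v"
    and "a \<noteq> b"
  shows "\<exists>r. is_cycle E r"
proof -
  have "v \<in> set (a # p)" "v \<in> set (b # q)"
    using p q unfolding simple_path_def by (metis last_ConsR last_in_set list.distinct(1))+
  then have "\<exists>x\<in>set (a # p). x \<in> set (b # q)" by blast
  then obtain p1 x p2 where ps: "a # p = p1 @ x # p2" and x: "x \<in> set (b # q)"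
    and disj: "\<forall>y\<in>set p1. y \<notin> set (b # q)"
    by (rule split_list_first_propE)
  from x obtain q1 q2 where qs: "b # q = q1 @ x # q2" by (meson split_list)
  let ?r = "u # p1 @ x # rev q1"
  have sp: "successively (\<lambda>x y. {x, y} \<in> E) (u # p1 @ x # p2)" "distinct (u # p1 @ x # p2)"
    using p unfolding simple_path_def ps by auto
  have sq: "successively (\<lambda>x y. {x, y} \<in> E) (u # q1 @ x # q2)" "distinct (u # q1 @ x # q2)"
    using q unfolding simple_path_def qs by auto
  have disj': "set p1 \<inter> set q1 = {}" using disj unfolding qs by auto
  have "\<not> (p1 = [] \<and> q1 = [])" using ps qs \<open>a \<noteq> b\<close> by auto
  then have len: "length ?r \<ge> 3" by (cases p1; cases q1) auto
  have "successively (\<lambda>x y. {x, y} \<in> E) (q1 @ [x])"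
    using sq(1) by (auto simp: successively_append_iff successively_Cons)
  then have rev: "successively (\<lambda>x y. {x, y} \<in> E) (x # rev q1)"
    using successively_edge_rev[of E "q1 @ [x]"] by simp
  have "successively (\<lambda>x y. {x, y} \<in> E) ((u # p1) @ (x # rev q1))"
    using sp(1) rev by (subst successively_append_iff)
      (auto simp: successively_append_iff successively_Cons)
  \<comment> \<open>The last vertex of \<open>?r\<close> is \<open>b\<close> in both cases: if
    \<open>q1\<close> is empty, then \<open>x = b\<close>.\<close>
  moreover have "{last ?r, hd ?r} \<in> E"
    using sq(1) by (cases q1) (auto simp: insert_commute)
  ultimately have "is_cycle E ?r"
    unfolding is_cycle_def using len sp(2) sq(2) disj' by auto
  then show ?thesis by blast
qed

text \<open>Two different second vertices would fork the paths and close a cycle, so the second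
  vertices agree and the induction hypothesis applies to the tails. Hence the definite description
  in \<open>tree_path\<close> is meaningful.\<close>

lemma simple_path_unique:
  assumes acyclic: "\<nexists>r. is_cycle E r"
    and "simple_path V E u p v" "simple_path V E u q v"
  shows "p = q"
  using assms(2,3)
proof (induction p arbitrary: u q)
  case Nil
  then show ?case by (simp add: simple_path_def)
next
  case (Cons a p)
  show ?case
  proof (cases "u = v")
    case True
    then show ?thesis using Cons.prems simple_path_closed by metis
  next
    case False
    from Cons.prems(1) False obtain b p' where p: "a = u" "p = b # p'"
      unfolding simple_path_def by (cases p) auto
    from Cons.prems(2) False obtain d q' where q: "q = u # d # q'"
      unfolding simple_path_def
      by (metis last_ConsL list.sel(1) neq_Nil_conv)
    have "b = d" using cycle_of_forked_paths acyclic Cons.prems p q by metis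
    then have "b # p' = d # q'"
      using Cons.IH[of b "d # q'"] Cons.prems simple_path_tl p q by metis
    then show ?thesis using p q by simp
  qed
qed

lemma tree_path_eqI:
  assumes "is_tree V E" "simple_path V E u p v"
  shows "tree_path V E u v = p"
  unfolding tree_path_def
  using assms(2)
proof (rule the_equality)
  show "r = p" if "simple_path V E u r v" for r
    using simple_path_unique[OF _ that assms(2)] assms(1) unfolding is_tree_def by blast
qed

lemma simple_path_tree_path:
  assumes "is_tree V E" "u \<in> V" "v \<in> V"
  shows "simple_path V E u (tree_path V E u v) v"
proof -
  obtain p where "simple_path V E u p v" using assms unfolding is_tree_def by blast
  then show ?thesis using tree_path_eqI[OF assms(1)] by metis
qed

section \<open>The path metric of the tree\<close>

lemma tree_dist_eqI:
  "is_tree V E \<Longrightarrow> simple_path V E u p v \<Longrightarrow> tree_dist V E u v = length p - 1"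
  by (simp add: tree_dist_def tree_path_eqI)

lemma tree_dist_commute:
  assumes "is_tree V E" "u \<in> V" "v \<in> V"
  shows "tree_dist V E u v = tree_dist V E v u"
  using tree_dist_eqI[OF assms(1) simple_path_tree_path[OF assms]]
    tree_dist_eqI[OF assms(1) simple_path_rev[OF simple_path_tree_path[OF assms]]]
  by simp

lemma tree_dist_self:
  assumes "is_tree V E" "u \<in> V"
  shows "tree_dist V E u u = 0"
  using simple_path_closed[OF simple_path_tree_path[OF assms assms(2)]]
  by (simp add: tree_dist_def)

lemma tree_dist_le_card:
  assumes "is_tree V E" "u \<in> V" "v \<in> V"
  shows "tree_dist V E u v \<le> card V"
proof -
  have "finite V" using assms(1) by (simp add: is_tree_def simple_graph_def)
  then have "length (tree_path V E u v) \<le> card V"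
    using simple_path_tree_path[OF assms] unfolding simple_path_def
    by (metis card_mono distinct_card)
  then show ?thesis by (simp add: tree_dist_def)
qed

lemma is_tree_edge_vertices:
  "is_tree V E \<Longrightarrow> {u, v} \<in> E \<Longrightarrow> u \<in> V \<and> v \<in> V"
  unfolding is_tree_def simple_graph_def by (metis doubleton_eq_iff)

text \<open>If \<open>w\<close> lies on the path to \<open>v\<close>, the prefix ending in
  \<open>w\<close> is the path to \<open>w\<close>; otherwise appending \<open>w\<close> gives that
  path. Uniqueness of paths turns either list into the exact distance.\<close>

lemma tree_dist_edge:
  assumes tree: "is_tree V E" and "u \<in> V" and vw: "{v, w} \<in> E"
  shows "tree_dist V E u w \<le> tree_dist V E u v + 1"
proof -
  have "v \<in> V" "w \<in> V" using is_tree_edge_vertices[OF tree vw] by auto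
  define p where "p = tree_path V E u v"
  have p: "simple_path V E u p v"
    unfolding p_def by (rule simple_path_tree_path) fact+
  show ?thesis
  proof (cases "w \<in> set p")
    case True
    then obtain p1 p2 where split: "p = p1 @ w # p2" by (meson split_list)
    then have "simple_path V E u (p1 @ [w]) w"
      using p unfolding simple_path_def
      by (auto simp: successively_append_iff successively_Cons hd_append)
    then show ?thesis
      using tree_dist_eqI[OF tree] p split by fastforce
  next
    case False
    then have "simple_path V E u (p @ [w]) w"
      using p vw \<open>w \<in> V\<close> unfolding simple_path_def
      by (auto simp: successively_append_iff)
    then show ?thesis
      using tree_dist_eqI[OF tree] p by fastforce
  qed
qed

text \<open>The tail of the path is itself a simple path, hence the tree path from the next vertex.
  This is why every non-null answer gains exactly one.\<close>

lemma tree_dist_next_vertex: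
  assumes tree: "is_tree V E" and "u \<in> V" "v \<in> V" "u \<noteq> v"
  shows "tree_path V E u v ! 1 \<in> V"
    and "tree_dist V E u v = Suc (tree_dist V E (tree_path V E u v ! 1) v)"
proof -
  have sp: "simple_path V E u (tree_path V E u v) v"
    by (rule simple_path_tree_path) fact+
  then obtain a p where p: "tree_path V E u v = u # a # p"
    using \<open>u \<noteq> v\<close> unfolding simple_path_def
    by (metis last_ConsL list.sel(1) neq_Nil_conv)
  show "tree_path V E u v ! 1 \<in> V" using sp unfolding p simple_path_def by simp
  have "tree_dist V E a v = length (a # p) - 1"
    using tree_dist_eqI[OF tree simple_path_tl] sp p by metis
  then show "tree_dist V E u v = Suc (tree_dist V E (tree_path V E u v ! 1) v)"
    unfolding tree_dist_def[of V E u v] p by simp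
qed

section \<open>Effect of swaps and queries on the distance\<close>

locale tree_tracking =
  fixes V :: "'v set" and E :: "'v set set" and ls :: "'l list" and c :: real
    and M :: "nat \<Rightarrow> 'l \<Rightarrow> 'v" and H0 :: "'l \<Rightarrow> 'v"
  assumes tree: "is_tree V E"
    and distinct_ls: "distinct ls"
    and bij_M0: "bij_betw (M 0) (set ls) V"
    and evolution: "evolution E M"
    and H0_in: "\<And>l. l \<in> set ls \<Longrightarrow> H0 l \<in> V"
    and c_gt_2: "c > 2"
begin

text \<open>Restriction to a set of labels: the invariant of an iteration needs the distance over
  the unprocessed labels besides the full one.\<close>

definition dist_on :: "'l set \<Rightarrow> ('l \<Rightarrow> 'v) \<Rightarrow> ('l \<Rightarrow> 'v) \<Rightarrow> nat" where
  "dist_on A T H = (\<Sum>l\<in>A. tree_dist V E (T l) (H l))"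

abbreviation st :: "nat \<Rightarrow> ('l, 'v) alg_state" where
  "st t \<equiv> alg_run V E ls c M H0 t"

definition swaps :: "nat \<Rightarrow> nat" where
  "swaps t = nat \<lfloor>real t / c\<rfloor>"

abbreviation dist_at_on :: "'l set \<Rightarrow> nat \<Rightarrow> nat" where
  "dist_at_on A t \<equiv> dist_on A (M (swaps t)) (hypothesis (st t))"

lemma truth_at_eq: "truth_at c M t = M (swaps t)"
  by (simp add: truth_at_def swaps_def)

lemma dist_at_eq: "dist_at V E ls c M H0 t = dist_at_on (set ls) t"
  by (simp add: dist_at_def total_dist_def dist_on_def truth_at_eq)

lemma length_ls: "length ls = card V"
  using bij_betw_same_card[OF bij_M0] distinct_card[OF distinct_ls] by simp

lemma length_ls_pos: "length ls > 0"
  using tree unfolding length_ls is_tree_def simple_graph_def by (simp add: card_gt_0_iff)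

lemma bij_M: "bij_betw (M k) (set ls) V"
proof (induction k)
  case (Suc k)
  have "evolver_step E (M k) (M (Suc k))" using evolution by (simp add: evolution_def)
  then consider u v where "{u, v} \<in> E" "M (Suc k) = transpose u v \<circ> M k" | "M (Suc k) = M k"
    unfolding evolver_step_def by blast
  then show ?case
  proof cases
    case 1
    then have "bij_betw (transpose u v) V V"
      using is_tree_edge_vertices[OF tree] by (simp add: bij_betw_transpose_iff)
    then show ?thesis using bij_betw_trans[OF Suc] 1 by metis
  qed (use Suc in simp)
qed (rule bij_M0)

lemma M_in: "l \<in> set ls \<Longrightarrow> M k l \<in> V"
  using bij_M bij_betwE by blast

text \<open>As \<open>T\<close> is injective, at most two labels of \<open>A\<close> sit on
  \<open>u\<close> or \<open>v\<close>, and each of them moves across a single edge.\<close>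

lemma dist_on_transpose:
  assumes "A \<subseteq> set ls" and T: "bij_betw T (set ls) V" and H: "\<And>l. l \<in> set ls \<Longrightarrow> H l \<in> V"
    and uv: "{u, v} \<in> E"
  shows "dist_on A (transpose u v \<circ> T) H \<le> dist_on A T H + 2"
proof -
  have fin: "finite A" using assms(1) finite_subset by blast
  have inj: "inj_on T A" using T assms(1) by (meson bij_betw_imp_inj_on inj_on_subset)
  let ?S = "{l \<in> A. T l \<in> {u, v}}"
  have "card ?S = card (T ` ?S)"
    by (rule card_image[symmetric]) (use inj in \<open>auto simp: inj_on_def\<close>)
  also have "\<dots> \<le> card {u, v}" by (rule card_mono) auto
  also have "\<dots> \<le> 2" by (simp add: card_insert_if)
  finally have S: "card ?S \<le> 2" .
  have step: "tree_dist V E (transpose u v (T l)) (H l)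
      \<le> tree_dist V E (T l) (H l) + (if T l \<in> {u, v} then 1 else 0)" if "l \<in> A" for l
  proof -
    have V: "u \<in> V" "v \<in> V" "H l \<in> V" "T l \<in> V"
      using is_tree_edge_vertices[OF tree uv] H that assms(1) bij_betwE[OF T] by auto
    have vu: "{v, u} \<in> E" using uv by (simp add: insert_commute)
    show ?thesis
      using tree_dist_edge[OF tree V(3) uv] tree_dist_edge[OF tree V(3) vu]
        tree_dist_commute[OF tree V(1,3)] tree_dist_commute[OF tree V(2,3)]
      by (auto simp: transpose_def)
  qed
  have "dist_on A (transpose u v \<circ> T) H
      \<le> (\<Sum>l\<in>A. tree_dist V E (T l) (H l) + (if T l \<in> {u, v} then 1 else 0))"
    unfolding dist_on_def by (rule sum_mono) (use step in simp)
  also have "\<dots> = dist_on A T H + card ?S"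
    using fin unfolding dist_on_def sum.distrib by (subst card_eq_sum, subst sum.inter_filter) auto
  finally show ?thesis using S by simp
qed

text \<open>Both directions come from the bound for one swap, since a swap undoes itself. On the
  one-vertex tree the labelling stays fixed.\<close>

lemma dist_on_evolve:
  assumes "A \<subseteq> set ls" and H: "\<And>l. l \<in> set ls \<Longrightarrow> H l \<in> V" and "a \<le> b"
  shows "dist_on A (M b) H \<le> dist_on A (M a) H + 2 * (b - a)"
    and "dist_on A (M a) H \<le> dist_on A (M b) H + 2 * (b - a)"
proof -
  have step: "dist_on A (M (Suc k)) H \<le> dist_on A (M k) H + 2 \<and>
      dist_on A (M k) H \<le> dist_on A (M (Suc k)) H + 2" for k
  proof -
    have "evolver_step E (M k) (M (Suc k))" using evolution by (simp add: evolution_def)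
    then consider u v where "{u, v} \<in> E" "M (Suc k) = transpose u v \<circ> M k" | "M (Suc k) = M k"
      unfolding evolver_step_def by blast
    then show ?thesis
    proof cases
      case 1
      then have swap_back: "transpose u v \<circ> M (Suc k) = M k" by (simp add: fun_eq_iff)
      show ?thesis
        using dist_on_transpose[OF assms(1) bij_M[of k] H 1(1), folded 1(2)]
          dist_on_transpose[OF assms(1) bij_M[of "Suc k"] H 1(1), unfolded swap_back] by simp
    qed simp
  qed
  have "dist_on A (M (a + m)) H \<le> dist_on A (M a) H + 2 * m \<and>
      dist_on A (M a) H \<le> dist_on A (M (a + m)) H + 2 * m" for m
  proof (induction m)
    case (Suc m)
    then show ?case using step[of "a + m"] by simp
  qed simp
  from this[of "b - a"] show "dist_on A (M b) H \<le> dist_on A (M a) H + 2 * (b - a)"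
    "dist_on A (M a) H \<le> dist_on A (M b) H + 2 * (b - a)"
    using \<open>a \<le> b\<close> by auto
qed

section \<open>Timing of the swaps, states of the algorithm, effect of one query\<close>

lemma swaps_mono: "s \<le> t \<Longrightarrow> swaps s \<le> swaps t"
  unfolding swaps_def using c_gt_2 by (intro nat_mono floor_mono divide_right_mono) auto

text \<open>The summand 1 pays for rounding down the swap count at time \<open>s\<close>.\<close>

lemma swaps_diff_le:
  assumes "s \<le> t"
  shows "real (swaps t - swaps s) \<le> real (t - s) / c + 1"
proof -
  have "real (swaps t) \<le> real t / c" "real (swaps s) > real s / c - 1"
    unfolding swaps_def using c_gt_2 by (simp add: of_nat_floor, linarith)
  then show ?thesis
    using swaps_mono[OF assms] assms by (simp add: of_nat_diff diff_divide_distrib)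
qed

lemma alg_step_null:
  assumes "M (swaps t) (ls ! cur_label (st t)) = hypothesis (st t) (ls ! cur_label (st t))"
  shows "st (Suc t) = (if Suc (cur_label (st t)) < length ls
           then (st t)\<lparr>cur_label := Suc (cur_label (st t))\<rparr>
           else (st t)\<lparr>cur_iter := Suc (cur_iter (st t)), cur_label := 0\<rparr>)"
  using assms by (simp add: alg_step_def path_query_def truth_at_eq Let_def)

lemma alg_step_move:
  assumes "M (swaps t) (ls ! cur_label (st t)) \<noteq> hypothesis (st t) (ls ! cur_label (st t))"
  shows "st (Suc t) = (st t)\<lparr>hypothesis := (hypothesis (st t))(ls ! cur_label (st t) :=
           tree_path V E (hypothesis (st t) (ls ! cur_label (st t)))
             (M (swaps t) (ls ! cur_label (st t))) ! 1)\<rparr>"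
  using assms by (simp add: alg_step_def path_query_def truth_at_eq Let_def)

lemma st_wf: "cur_label (st t) < length ls \<and> (\<forall>l\<in>set ls. hypothesis (st t) l \<in> V)"
proof (induction t)
  case 0
  then show ?case using length_ls_pos H0_in by simp
next
  case (Suc t)
  let ?l = "ls ! cur_label (st t)"
  have l: "?l \<in> set ls" using Suc by simp
  show ?case
  proof (cases "M (swaps t) ?l = hypothesis (st t) ?l")
    case True
    show ?thesis using Suc length_ls_pos unfolding alg_step_null[OF True] by simp
  next
    case False
    show ?thesis
      using Suc tree_dist_next_vertex(1)[OF tree _ M_in[OF l] False[symmetric]] l
      unfolding alg_step_move[OF False] by simp
  qed
qed

lemma cur_label_less: "cur_label (st t) < length ls"
  and hypothesis_in: "l \<in> set ls \<Longrightarrow> hypothesis (st t) l \<in> V"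
  using st_wf by blast+

lemma cur_iter_mono: "s \<le> t \<Longrightarrow> cur_iter (st s) \<le> cur_iter (st t)"
proof (induction t rule: dec_induct)
  case (step t)
  then show ?case
    using alg_step_null[of t] alg_step_move[of t]
    by (cases "M (swaps t) (ls ! cur_label (st t)) = hypothesis (st t) (ls ! cur_label (st t))")
      (auto simp del: alg_run.simps split: if_splits)
qed simp

lemma dist_on_move:
  assumes "finite A" "l \<in> A" "T l \<in> V" "H l \<in> V" "T l \<noteq> H l"
  shows "dist_on A T H = Suc (dist_on A T (H(l := tree_path V E (H l) (T l) ! 1)))"
proof -
  let ?x = "tree_path V E (H l) (T l) ! 1"
  have x: "?x \<in> V" "tree_dist V E (H l) (T l) = Suc (tree_dist V E ?x (T l))"
    using tree_dist_next_vertex[OF tree assms(4,3)] assms(5) by auto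
  have "tree_dist V E (T l) (H l) = Suc (tree_dist V E (T l) ?x)"
    using x tree_dist_commute[OF tree] assms(3,4) by metis
  moreover have "(\<Sum>y\<in>A - {l}. tree_dist V E (T y) ((H(l := ?x)) y))
      = (\<Sum>y\<in>A - {l}. tree_dist V E (T y) (H y))"
    by (rule sum.cong) auto
  ultimately show ?thesis
    unfolding dist_on_def sum.remove[OF assms(1,2)] by (simp del: One_nat_def)
qed

section \<open>One iteration\<close>

text \<open>\<open>m\<close> counts the non-null answers since time \<open>t0\<close>; only the labels that are still to be
  processed contribute to the last inequality.\<close>

definition progress :: "nat \<Rightarrow> nat \<Rightarrow> nat \<Rightarrow> nat \<Rightarrow> bool" where
  "progress t0 t k m \<longleftrightarrow> t = t0 + k + m \<and>
     dist_at_on (set ls) t + m \<le> dist_at_on (set ls) t0 + 2 * (swaps t - swaps t0) \<and>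
     dist_at_on (set ls) t0 \<le> dist_at_on (set (drop k ls)) t + m + 2 * (swaps t - swaps t0)"

lemma progress_null:
  assumes prog: "progress t0 t (cur_label (st t)) m"
    and null: "M (swaps t) (ls ! cur_label (st t)) = hypothesis (st t) (ls ! cur_label (st t))"
  shows "progress t0 (Suc t) (Suc (cur_label (st t))) m"
proof -
  let ?k = "cur_label (st t)" and ?H = "hypothesis (st t)"
  have k: "?k < length ls" by (rule cur_label_less)
  have H': "hypothesis (st (Suc t)) = ?H" unfolding alg_step_null[OF null] by simp
  have le: "swaps t0 \<le> swaps t" "swaps t \<le> swaps (Suc t)"
    using prog by (auto simp: progress_def intro: swaps_mono)
  have "set (drop ?k ls) = insert (ls ! ?k) (set (drop (Suc ?k) ls))"
    using Cons_nth_drop_Suc[OF k] by (metis list.simps(15))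
  moreover have "ls ! ?k \<notin> set (drop (Suc ?k) ls)"
    using Cons_nth_drop_Suc[OF k] distinct_ls by (metis distinct.simps(2) distinct_drop)
  moreover have "tree_dist V E (M (swaps t) (ls ! ?k)) (?H (ls ! ?k)) = 0"
    using null tree_dist_self[OF tree] hypothesis_in k by simp
  ultimately have drop: "dist_at_on (set (drop ?k ls)) t = dist_at_on (set (drop (Suc ?k) ls)) t"
    by (simp add: dist_on_def)
  \<comment> \<open>The hypothesis stays fixed while the truth passes from time \<open>t\<close> to
    \<open>Suc t\<close>. Each swap in between costs 2 in either inequality, which the growing swap
    count absorbs.\<close>
  have "dist_on (set ls) (M (swaps (Suc t))) ?H
      \<le> dist_on (set ls) (M (swaps t)) ?H + 2 * (swaps (Suc t) - swaps t)"
    by (rule dist_on_evolve(1)) (use le hypothesis_in in auto)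
  moreover have "dist_on (set (drop (Suc ?k) ls)) (M (swaps t)) ?H
      \<le> dist_on (set (drop (Suc ?k) ls)) (M (swaps (Suc t))) ?H + 2 * (swaps (Suc t) - swaps t)"
    by (rule dist_on_evolve(2)) (use le hypothesis_in in \<open>auto dest: in_set_dropD\<close>)
  ultimately show ?thesis
    using prog drop le unfolding progress_def H' by simp linarith
qed

text \<open>The current label belongs to both label sets, so both distances drop by exactly 1,
  measured against the truth that the query saw; the increment of \<open>m\<close> compensates.
  Swaps at the following time unit are charged afterwards.\<close>

lemma progress_move:
  assumes prog: "progress t0 t (cur_label (st t)) m"
    and move: "M (swaps t) (ls ! cur_label (st t)) \<noteq> hypothesis (st t) (ls ! cur_label (st t))"
  shows "progress t0 (Suc t) (cur_label (st t)) (Suc m)"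
proof -
  let ?k = "cur_label (st t)" and ?H = "hypothesis (st t)" and ?H' = "hypothesis (st (Suc t))"
  let ?R = "set (drop ?k ls)"
  have k: "?k < length ls" by (rule cur_label_less)
  have H': "?H' = ?H(ls ! ?k := tree_path V E (?H (ls ! ?k)) (M (swaps t) (ls ! ?k)) ! 1)"
    unfolding alg_step_move[OF move] by simp
  have le: "swaps t0 \<le> swaps t" "swaps t \<le> swaps (Suc t)"
    using prog by (auto simp: progress_def intro: swaps_mono)
  have dec: "dist_on A (M (swaps t)) ?H = Suc (dist_on A (M (swaps t)) ?H')"
    if "finite A" "ls ! ?k \<in> A" for A
    unfolding H' using that move k by (intro dist_on_move) (auto intro: M_in hypothesis_in)
  have "ls ! ?k \<in> ?R" using Cons_nth_drop_Suc[OF k] by (metis list.set_intros(1))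
  then have "dist_on ?R (M (swaps t)) ?H = Suc (dist_on ?R (M (swaps t)) ?H')"
    by (intro dec) auto
  moreover have "dist_on (set ls) (M (swaps t)) ?H = Suc (dist_on (set ls) (M (swaps t)) ?H')"
    using k by (intro dec) auto
  moreover have "dist_on (set ls) (M (swaps (Suc t))) ?H'
      \<le> dist_on (set ls) (M (swaps t)) ?H' + 2 * (swaps (Suc t) - swaps t)"
    by (rule dist_on_evolve(1)) (use le hypothesis_in in \<open>auto simp del: alg_run.simps\<close>)
  moreover have "dist_on ?R (M (swaps t)) ?H'
      \<le> dist_on ?R (M (swaps (Suc t))) ?H' + 2 * (swaps (Suc t) - swaps t)"
    by (rule dist_on_evolve(2))
      (use le hypothesis_in in \<open>auto simp del: alg_run.simps dest: in_set_dropD\<close>)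
  ultimately show ?thesis
    using prog le unfolding progress_def by (simp del: alg_run.simps) linarith
qed

text \<open>When the iteration ends, \<open>cur_label\<close> is reset to 0, so the invariant is
  recorded at \<open>length ls\<close> instead, where no label is left to process.\<close>

lemma iteration_step:
  assumes "cur_iter (st t) = j" "progress t0 t (cur_label (st t)) m"
  shows "(cur_iter (st (Suc t)) = j \<and> (\<exists>m. progress t0 (Suc t) (cur_label (st (Suc t))) m)) \<or>
    (cur_iter (st (Suc t)) = Suc j \<and> cur_label (st (Suc t)) = 0 \<and>
      (\<exists>m. progress t0 (Suc t) (length ls) m))"
proof (cases "M (swaps t) (ls ! cur_label (st t)) = hypothesis (st t) (ls ! cur_label (st t))")
  case True
  have "Suc (cur_label (st t)) < length ls \<or> Suc (cur_label (st t)) = length ls"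
    using cur_label_less[of t] by linarith
  then show ?thesis
    using progress_null[OF assms(2) True] assms(1) alg_step_null[OF True]
    by (auto simp del: alg_run.simps)
next
  case False
  then show ?thesis
    using progress_move[OF assms(2) False] assms(1) alg_step_move[OF False]
    by (auto simp del: alg_run.simps)
qed

text \<open>The elapsed time is \<open>k + m\<close>, where \<open>m\<close> is at most the initial
  distance plus twice the swaps, and these take up only a fraction \<open>2 / c\<close> of the time,
  up to rounding. As \<open>c > 2\<close>, an iteration cannot last forever.\<close>

lemma progress_time_bounded:
  assumes "progress t0 t k m" "k \<le> length ls"
  shows "(1 - 2 / c) * real (t - t0) \<le> real (dist_at_on (set ls) t0) + real (length ls) + 2"
proof -
  have "real m \<le> real (dist_at_on (set ls) t0) + 2 * real (swaps t - swaps t0)"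
    using assms(1) unfolding progress_def by linarith
  moreover have "t - t0 = k + m" "t0 \<le> t" using assms(1) unfolding progress_def by auto
  ultimately show ?thesis
    using swaps_diff_le[of t0 t] assms(2)
    unfolding left_diff_distrib times_divide_eq_left times_divide_eq_right[symmetric] by linarith
qed

lemma progress_contraction:
  assumes "progress t0 t (length ls) m"
  shows "real (dist_at_on (set ls) t)
    \<le> 4 / (c + 2) * real (dist_at_on (set ls) t0) + 5 * real (length ls)"
proof -
  define D D' n x w where "D = real (dist_at_on (set ls) t0)" and "D' = real (dist_at_on (set ls) t)"
    and "n = real (length ls)" and "x = real m" and "w = real (swaps t - swaps t0)"
  have t: "t - t0 = length ls + m" "t0 \<le> t"
    and 1: "dist_at_on (set ls) t + m \<le> dist_at_on (set ls) t0 + 2 * (swaps t - swaps t0)"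
    and 2: "dist_at_on (set ls) t0 \<le> m + 2 * (swaps t - swaps t0)"
    using assms by (auto simp: progress_def dist_on_def)
  have up: "D' + x \<le> D + 2 * w" using 1 unfolding D_def D'_def x_def w_def by linarith
  have low: "D \<le> x + 2 * w" using 2 unfolding D_def x_def w_def by linarith
  have "w \<le> (n + x) / c + 1"
    using swaps_diff_le[OF t(2)] unfolding t(1) w_def n_def x_def by simp
  then have w: "c * w \<le> n + x + c" using c_gt_2 by (simp add: field_simps)
  have n: "n \<ge> 1" using length_ls_pos unfolding n_def by linarith
  have "(c + 2) * D' \<le> (c + 2) * (D - x + 2 * w)"
    using up c_gt_2 by (intro mult_left_mono) auto
  also have "\<dots> = 4 * D + (c - 2) * D - (c + 2) * x + 2 * (c + 2) * w"
    by (simp add: algebra_simps)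
  \<comment> \<open>The weight \<open>c - 2\<close> is chosen so that \<open>x\<close> and
    \<open>w\<close> combine to a multiple of \<open>c * w - x\<close>, which \<open>w\<close>
    bounds by \<open>n + c\<close>. It is positive because \<open>c > 2\<close>, so the lower bound
    \<open>low\<close> may be used.\<close>
  also have "\<dots> \<le> 4 * D + (c - 2) * (x + 2 * w) - (c + 2) * x + 2 * (c + 2) * w"
    using mult_left_mono[OF low, of "c - 2"] c_gt_2 by simp
  also have "\<dots> = 4 * D + 4 * (c * w - x)" by (simp add: algebra_simps)
  also have "\<dots> \<le> 4 * D + 4 * (n + c)" using w by simp
  \<comment> \<open>The additive \<open>c\<close> left by rounding is absorbed because
    \<open>n \<ge> 1\<close>.\<close>
  also have "\<dots> \<le> 4 * D + (c + 2) * (5 * n)"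
  proof -
    have "c * 4 \<le> c * (5 * n)" using n c_gt_2 by (intro mult_left_mono) auto
    then show ?thesis using n by (simp only: distrib_left distrib_right)
  qed
  finally have "(c + 2) * D' \<le> 4 * D + (c + 2) * (5 * n)" .
  then show ?thesis
    using c_gt_2 unfolding D_def D'_def n_def by (simp add: field_simps)
qed

text \<open>The first time at which the invariant fails is the start of the next iteration; it
  exists by the time bound. The condition on \<open>cur_label\<close> is carried along so that the
  invariant can start afresh with \<open>k = m = 0\<close>.\<close>

lemma next_iteration:
  assumes start: "iteration_starts V E ls c M H0 j t0" and label: "cur_label (st t0) = 0"
  obtains t where "iteration_starts V E ls c M H0 (Suc j) t" "cur_label (st t) = 0"
    "real (dist_at_on (set ls) t)
      \<le> 4 / (c + 2) * real (dist_at_on (set ls) t0) + 5 * real (length ls)"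
proof -
  define inv where "inv t \<longleftrightarrow> cur_iter (st t) = j \<and> (\<exists>m. progress t0 t (cur_label (st t)) m)" for t
  have inv0: "inv t0"
    using start label unfolding inv_def iteration_starts_def
    by (auto simp: progress_def intro: exI[of _ 0])
  have "\<exists>i. \<not> inv (t0 + i)"
  proof (rule ccontr)
    assume "\<not> ?thesis"
    then have bound: "(1 - 2 / c) * real i \<le> real (dist_at_on (set ls) t0) + real (length ls) + 2" for i
      using progress_time_bounded[of t0 "t0 + i" "cur_label (st (t0 + i))"] cur_label_less[of "t0 + i"]
      unfolding inv_def by fastforce
    have "1 - 2 / c > 0" using c_gt_2 by (simp add: field_simps)
    then obtain i where "real (dist_at_on (set ls) t0) + real (length ls) + 2 < real i * (1 - 2 / c)"
      using ex_less_of_nat_mult by blast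
    then show False using bound[of i] by (simp add: mult.commute)
  qed
  then obtain i where i: "\<not> inv (t0 + i)" and min: "\<And>i'. i' < i \<Longrightarrow> inv (t0 + i')"
    using exists_least_iff[of "\<lambda>i. \<not> inv (t0 + i)"] by blast
  obtain i' where i': "i = Suc i'" using i inv0 by (cases i) auto
  define t where "t = Suc (t0 + i')"
  have "\<not> inv t" "inv (t0 + i')" using i min unfolding i' t_def by auto
  then obtain m where t: "cur_iter (st t) = Suc j" "cur_label (st t) = 0" "progress t0 t (length ls) m"
    using iteration_step[of "t0 + i'" j t0] unfolding inv_def t_def by blast
  \<comment> \<open>At the last time before \<open>t\<close> the counter is still \<open>j\<close>,
    and it never decreases, so \<open>t\<close> is the first time with value
    \<open>Suc j\<close>.\<close>
  have "cur_iter (st s) \<noteq> Suc j" if "s < t" for s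
  proof -
    have "cur_iter (st s) \<le> cur_iter (st (t0 + i'))"
      using that cur_iter_mono unfolding t_def by simp
    then show ?thesis using \<open>inv (t0 + i')\<close> unfolding inv_def by simp
  qed
  then have "iteration_starts V E ls c M H0 (Suc j) t"
    using t(1) unfolding iteration_starts_def by blast
  then show ?thesis using that t progress_contraction by blast
qed

section \<open>Geometric decay over the iterations and the linear bound\<close>

lemma dist_at_iteration:
  "\<exists>t. iteration_starts V E ls c M H0 (Suc j) t \<and> cur_label (st t) = 0 \<and>
    real (dist_at_on (set ls) t)
      \<le> (4 / (c + 2)) ^ j * (real (length ls))\<^sup>2 + 5 * real (length ls) / (1 - 4 / (c + 2))"
proof (induction j)
  case 0
  \<comment> \<open>Iterations are numbered from 1, so the base case is the initial state: each of
    the \<open>n\<close> labels is off by at most \<open>n\<close>.\<close>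
  have "dist_at_on (set ls) 0 \<le> (\<Sum>l\<in>set ls. length ls)"
    unfolding dist_on_def length_ls
    by (intro sum_mono tree_dist_le_card[OF tree]) (auto intro: M_in hypothesis_in simp del: alg_run.simps)
  also have "\<dots> = (length ls)\<^sup>2" by (simp add: distinct_card[OF distinct_ls] power2_eq_square)
  finally have "real (dist_at_on (set ls) 0) \<le> (real (length ls))\<^sup>2"
    by (metis of_nat_le_iff of_nat_power)
  moreover have "5 * real (length ls) / (1 - 4 / (c + 2)) \<ge> 0"
    using c_gt_2 by (intro divide_nonneg_nonneg) (auto simp: field_simps)
  ultimately have "real (dist_at_on (set ls) 0)
      \<le> (4 / (c + 2)) ^ 0 * (real (length ls))\<^sup>2 + 5 * real (length ls) / (1 - 4 / (c + 2))"
    unfolding power_0 mult_1 by linarith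
  moreover have "iteration_starts V E ls c M H0 (Suc 0) 0" "cur_label (st 0) = 0"
    by (simp_all add: iteration_starts_def)
  ultimately show ?case by blast
next
  case (Suc j)
  define q where "q = 4 / (c + 2)"
  have q: "0 < q" "q < 1" using c_gt_2 unfolding q_def by auto
  let ?n = "real (length ls)"
  obtain t0 where t0: "iteration_starts V E ls c M H0 (Suc j) t0" "cur_label (st t0) = 0"
    and D: "real (dist_at_on (set ls) t0) \<le> q ^ j * ?n\<^sup>2 + 5 * ?n / (1 - q)"
    using Suc unfolding q_def by blast
  obtain t where t: "iteration_starts V E ls c M H0 (Suc (Suc j)) t" "cur_label (st t) = 0"
    and D': "real (dist_at_on (set ls) t) \<le> q * real (dist_at_on (set ls) t0) + 5 * ?n"
    using next_iteration[OF t0] unfolding q_def by blast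
  have "q * real (dist_at_on (set ls) t0) + 5 * ?n
      \<le> q * (q ^ j * ?n\<^sup>2 + 5 * ?n / (1 - q)) + 5 * ?n"
    using D q by (simp del: alg_run.simps)
  \<comment> \<open>The second summand is the fixed point of the recurrence
    \<open>x = q * x + 5 * ?n\<close>, so only the quadratic term shrinks.\<close>
  also have "\<dots> = q ^ Suc j * ?n\<^sup>2 + 5 * ?n / (1 - q)"
    using q by (simp add: field_simps)
  finally show ?case using t D' unfolding q_def by (meson order_trans)
qed

end

theorem theorem9:
  fixes c :: real
  assumes "c > 2"
  shows "\<exists>(z :: nat \<Rightarrow> nat) (B :: nat \<Rightarrow> real). B \<in> O(\<lambda>n. real n) \<and>
    (\<forall>n (V :: 'v set) E (ls :: 'l list) M H0.
       is_tree V E \<and> card V = n \<and>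
       distinct ls \<and> bij_betw (M 0) (set ls) V \<and> evolution E M \<and>
       (\<forall>l\<in>set ls. H0 l \<in> V) \<longrightarrow>
       (\<forall>j>z n. \<exists>t. iteration_starts V E ls c M H0 j t \<and>
                    real (dist_at V E ls c M H0 t) \<le> B n))"
proof -
  define q where "q = 4 / (c + 2)"
  have q: "0 < q" "q < 1" using assms unfolding q_def by auto
  \<comment> \<open>After that many iterations the initial term, at most \<open>q ^ k\<close> times
    the square of \<open>n\<close>, has shrunk to at most \<open>n\<close>. Comparing with
    \<open>n + 1\<close> keeps the denominator positive for \<open>n = 0\<close>.\<close>
  have "\<exists>k. q ^ k * real n \<le> 1" for n
  proof -
    obtain k where "q ^ k < 1 / (real n + 1)"
      using real_arch_pow_inv[of "1 / (real n + 1)" q] q by auto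
    then have "q ^ k * (real n + 1) < 1" by (simp add: field_simps)
    moreover have "q ^ k * real n \<le> q ^ k * (real n + 1)" using q by simp
    ultimately show ?thesis by (meson less_imp_le order_trans)
  qed
  then obtain z where z: "\<And>n. q ^ z n * real n \<le> 1" by metis
  \<comment> \<open>One \<open>n\<close> for what is left of the initial distance, the rest for the
    fixed point of the recurrence.\<close>
  define B where "B n = (1 + 5 / (1 - q)) * real n" for n
  have "B \<in> O(\<lambda>n. real n)" unfolding B_def by simp
  moreover have "\<exists>t. iteration_starts V E ls c M H0 j t \<and> real (dist_at V E ls c M H0 t) \<le> B n"
    if *: "is_tree V E \<and> card V = n \<and> distinct ls \<and> bij_betw (M 0) (set ls) V \<and> evolution E M \<and>
       (\<forall>l\<in>set ls. H0 l \<in> V)" and "j > z n"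
    for n j and V :: "'v set" and E and ls :: "'l list" and M H0
  proof -
    interpret tree_tracking V E ls c M H0
      by unfold_locales (use * assms in auto)
    have n: "length ls = n" using length_ls * by simp
    \<comment> \<open>Iteration \<open>Suc i\<close> starts after \<open>i\<close> contractions, so
      the strict \<open>j > z n\<close> supplies the required exponent.\<close>
    obtain i where j: "j = Suc i" "z n \<le> i" using \<open>j > z n\<close> by (cases j) auto
    obtain t where t: "iteration_starts V E ls c M H0 j t"
      and D: "real (dist_at V E ls c M H0 t) \<le> q ^ i * (real n)\<^sup>2 + 5 * real n / (1 - q)"
      using dist_at_iteration[of i] unfolding n j dist_at_eq q_def by blast
    have "q ^ i * real n \<le> q ^ z n * real n"
      using q j by (intro mult_right_mono power_decreasing) auto
    also note z
    finally have "q ^ i * real n * real n \<le> 1 * real n" by (intro mult_right_mono) auto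
    then have "q ^ i * (real n)\<^sup>2 + 5 * real n / (1 - q) \<le> B n"
      unfolding B_def by (simp add: power2_eq_square algebra_simps)
    then show ?thesis using t D by (meson order_trans)
  qed
  ultimately show ?thesis by blast
qed

end
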